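(* Let $G$ be a finite simple graph without isolated vertices with minimum degree $\delta(G)=1$ and maximum degree $\Delta(G)$. Then $C_{tr}(G)\le \Delta(G)+1$.
   Context: A set $S\subseteq V$ is a total restrained dominating set (TRD-set) of $G=(V,E)$ if every vertex of $V\setminus S$ is adjacent to at least one vertex of $S$ and to at least one other vertex of $V\setminus S$, and every vertex of $S$ is adjacent to at least one other vertex of $S$. Two disjoint sets $X,Y\subseteq V$ form a total restrained coalition if neither is a TRD-set but $X\cup Y$ is a TRD-set. A trc-partition of $G$ is a partition $\Phi$ of $V$ such that no member of $\Phi$ is a TRD-set and each member forms a total restrained coalition with some other member of $\Phi$. $C_{tr}(G)$ is the maximum cardinality of a trc-partition of $G$. *)

theory Defs
  imports "Graph_Theory.Digraph" "HOL-Library.Disjoint_Sets"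
begin

text \<open>
  Finite simple graphs are taken from the AFP entry \<open>Graph_Theory\<close>: the locale \<^locale>\<open>graph\<close>
  describes finite symmetric digraphs without loops and parallel arcs. Every undirected edge
  corresponds to a pair of opposite arcs, so the degree of a vertex is its \<^const>\<open>out_degree\<close>.
\<close>

definition min_degree :: "('a, 'b) pre_digraph \<Rightarrow> nat" where
  "min_degree G = Min (out_degree G ` verts G)"

definition max_degree :: "('a, 'b) pre_digraph \<Rightarrow> nat" where
  "max_degree G = Max (out_degree G ` verts G)"

definition isolated_vertex :: "('a, 'b) pre_digraph \<Rightarrow> 'a \<Rightarrow> bool" where
  "isolated_vertex G v \<longleftrightarrow> v \<in> verts G \<and> \<not> (\<exists>u\<in>verts G. v \<rightarrow>\<^bsub>G\<^esub> u)"

definition TRD_set :: "('a, 'b) pre_digraph \<Rightarrow> 'a set \<Rightarrow> bool" where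
  "TRD_set G S \<longleftrightarrow> S \<subseteq> verts G \<and>
     (\<forall>v\<in>verts G - S. (\<exists>u\<in>S. v \<rightarrow>\<^bsub>G\<^esub> u) \<and> (\<exists>u\<in>verts G - S. u \<noteq> v \<and> v \<rightarrow>\<^bsub>G\<^esub> u)) \<and>
     (\<forall>v\<in>S. \<exists>u\<in>S. u \<noteq> v \<and> v \<rightarrow>\<^bsub>G\<^esub> u)"

definition total_restrained_coalition ::
    "('a, 'b) pre_digraph \<Rightarrow> 'a set \<Rightarrow> 'a set \<Rightarrow> bool" where
  "total_restrained_coalition G X Y \<longleftrightarrow>
     X \<subseteq> verts G \<and> Y \<subseteq> verts G \<and> X \<inter> Y = {} \<and>
     \<not> TRD_set G X \<and> \<not> TRD_set G Y \<and> TRD_set G (X \<union> Y)"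

definition trc_partition :: "('a, 'b) pre_digraph \<Rightarrow> 'a set set \<Rightarrow> bool" where
  "trc_partition G \<Phi> \<longleftrightarrow> partition_on (verts G) \<Phi> \<and>
     (\<forall>X\<in>\<Phi>. \<not> TRD_set G X) \<and>
     (\<forall>X\<in>\<Phi>. \<exists>Y\<in>\<Phi>. Y \<noteq> X \<and> total_restrained_coalition G X Y)"

text \<open>
  The maximum is only meaningful if there is a trc-partition; the facts
  \<open>finite_trc_partitions\<close> and \<open>trc_partition_exists\<close> show that it is one over a finite
  nonempty set for every nonempty graph without isolated vertices.
\<close>

definition C_tr :: "('a, 'b) pre_digraph \<Rightarrow> nat" where
  "C_tr G = Max {card \<Phi> |\<Phi>. trc_partition G \<Phi>}"

lemma finite_trc_partitions:
  assumes "graph G"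
  shows "finite {\<Phi>. trc_partition G \<Phi>}"
proof -
  interpret graph G by fact
  have "{\<Phi>. trc_partition G \<Phi>} \<subseteq> Pow (Pow (verts G))"
    by (auto simp: trc_partition_def partition_on_def)
  then show ?thesis
    by (rule finite_subset) simp
qed

lemma trc_partition_exists:
  assumes "graph G" and "verts G \<noteq> {}" and "\<And>v. \<not> isolated_vertex G v"
  shows "\<exists>\<Phi>. trc_partition G \<Phi>"
proof -
  interpret graph G by fact
  have loop: "\<not> u \<rightarrow>\<^bsub>G\<^esub> u" for u
    using no_loops by (auto simp: arcs_ends_conv)
  from assms(2) obtain v where v: "v \<in> verts G" by blast
  have nb: "\<exists>u\<in>verts G. w \<rightarrow>\<^bsub>G\<^esub> u" if "w \<in> verts G" for w
    using assms(3)[of w] that by (auto simp: isolated_vertex_def)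
  obtain u where u: "u \<in> verts G" "v \<rightarrow>\<^bsub>G\<^esub> u"
    using nb[OF v] by blast
  have "u \<noteq> v" using u loop by auto
  let ?R = "verts G - {v}"
  have 1: "\<not> TRD_set G {v}" by (auto simp: TRD_set_def)
  have 2: "\<not> TRD_set G ?R" using v by (auto simp: TRD_set_def)
  have "\<exists>y\<in>verts G. y \<noteq> w \<and> w \<rightarrow>\<^bsub>G\<^esub> y" if "w \<in> verts G" for w
    using nb[OF that] loop[of w] by metis
  then have 3: "TRD_set G (verts G)"
    by (simp add: TRD_set_def)
  have ins: "insert v (verts G) = verts G" using v by blast
  have "trc_partition G {{v}, ?R}"
    unfolding trc_partition_def
  proof (intro conjI)
    show "partition_on (verts G) {{v}, ?R}"
      using v u \<open>u \<noteq> v\<close> by (auto simp: partition_on_def disjoint_def)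
    show "\<forall>X\<in>{{v}, ?R}. \<not> TRD_set G X" using 1 2 by simp
    show "\<forall>X\<in>{{v}, ?R}. \<exists>Y\<in>{{v}, ?R}. Y \<noteq> X \<and> total_restrained_coalition G X Y"
      using 1 2 3 v by (auto simp: total_restrained_coalition_def ins)
  qed
  then show ?thesis by blast
qed

end

theory Submission
  imports Defs
begin

text \<open>
  A vertex \<open>x\<close> of degree 1 lies in every TRD-set, as a vertex outside a TRD-set needs a neighbour
  on either side. Hence every member of a trc-partition other than the member \<open>X\<close> containing \<open>x\<close>
  has \<open>X\<close> as its partner. Take a vertex \<open>v\<close> at which \<open>X\<close> fails to be a TRD-set. If \<open>v\<close> has no
  neighbour in \<open>X\<close>, then each other member must contain a neighbour of \<open>v\<close>, so there are at most
  \<open>\<Delta>\<close> of them. If \<open>v \<notin> X\<close> has no neighbour outside \<open>X\<close>, then each other member must contain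
  \<open>v\<close>, so there is only one.
\<close>

text \<open>Choosing a point of \<open>N\<close> in each member of \<open>\<A>\<close> is injective,
  because disjoint members cannot share the chosen point.\<close>

lemma card_le_if_disjoint_meets:
  assumes "finite N" "disjoint \<A>" "\<And>A. A \<in> \<A> \<Longrightarrow> A \<inter> N \<noteq> {}"
  shows "card \<A> \<le> card N"
proof -
  have "\<forall>A\<in>\<A>. \<exists>a. a \<in> A \<inter> N"
    using assms(3) by auto
  then obtain f where f: "\<forall>A\<in>\<A>. f A \<in> A \<inter> N"
    by (rule bchoice [THEN exE])
  have "inj_on f \<A>"
  proof (rule inj_onI)
    fix A B assume "A \<in> \<A>" "B \<in> \<A>" "f A = f B"
    moreover from this have "f A \<in> A \<inter> B"
      using f by (metis Int_iff)
    ultimately show "A = B"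
      using assms(2) by (auto simp: disjoint_def)
  qed
  then show ?thesis
    using f assms(1) by (intro card_inj_on_le[of f]) auto
qed

text \<open>Neighbours are the heads of outgoing arcs. In a \<open>fin_digraph\<close> parallel arcs
  may share a head, hence only an inequality.\<close>

lemma (in fin_digraph) neighbours_bounded:
  shows "finite {u. v \<rightarrow> u}" and "card {u. v \<rightarrow> u} \<le> out_degree G v"
proof -
  have eq: "{u. v \<rightarrow> u} = head G ` out_arcs G v"
    by (auto simp: arcs_ends_conv out_arcs_def)
  show "finite {u. v \<rightarrow> u}"
    unfolding eq using finite_out_arcs by (rule finite_imageI)
  show "card {u. v \<rightarrow> u} \<le> out_degree G v"
    unfolding eq out_degree_def using finite_out_arcs by (rule card_image_le)
qed

lemma (in fin_digraph) out_degree_le_max_degree: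
  "v \<in> verts G \<Longrightarrow> out_degree G v \<le> max_degree G"
  unfolding max_degree_def by (rule Max_ge) auto

lemma (in fin_digraph) degree_1_in_TRD_set:
  assumes "TRD_set G S" "x \<in> verts G" "out_degree G x = 1"
  shows "x \<in> S"
proof (rule ccontr)
  assume "x \<notin> S"
  then obtain u w where uw: "u \<in> S" "x \<rightarrow> u" "w \<notin> S" "x \<rightarrow> w"
    using assms(1,2) unfolding TRD_set_def by blast
  \<comment> \<open>\<open>u\<close> and \<open>w\<close> are distinct, since only \<open>u\<close>
    lies in \<open>S\<close>; so \<open>x\<close> has two neighbours.\<close>
  have "card {u, w} \<le> card {u. x \<rightarrow> u}"
    using uw neighbours_bounded(1) by (intro card_mono) auto
  also have "\<dots> \<le> 1"
    using neighbours_bounded(2)[of x] assms(3) by simp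
  finally show False
    using uw by (auto simp: card_insert_if split: if_splits)
qed

lemma (in fin_digraph) card_le_if_common_partner:
  assumes "disjoint \<A>" "X \<subseteq> verts G" "\<not> TRD_set G X" "max_degree G \<ge> 1"
    and TRD: "\<And>A. A \<in> \<A> \<Longrightarrow> TRD_set G (A \<union> X)"
  shows "card \<A> \<le> max_degree G"
\<comment> \<open>The condition joins both domination clauses, for \<open>v\<close> outside
  \<open>X\<close> and for \<open>v\<close> in \<open>X\<close>. If it fails, only the restrained
  clause can be violated.\<close>
proof (cases "\<exists>v\<in>verts G. \<forall>u\<in>X. \<not> (v \<rightarrow> u \<and> (v \<in> X \<longrightarrow> u \<noteq> v))")
  case True
  then obtain v where v: "v \<in> verts G" "\<And>u. u \<in> X \<Longrightarrow> \<not> (v \<rightarrow> u \<and> (v \<in> X \<longrightarrow> u \<noteq> v))"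
    by blast
  \<comment> \<open>Whether or not \<open>v\<close> lies in \<open>A \<union> X\<close>, it has a
    neighbour there, distinct from \<open>v\<close> if \<open>v \<in> X\<close>; by the choice of
    \<open>v\<close> this neighbour is not in \<open>X\<close>.\<close>
  have "A \<inter> {u. v \<rightarrow> u} \<noteq> {}" if "A \<in> \<A>" for A
    using TRD[OF that] v unfolding TRD_set_def by blast
  then have "card \<A> \<le> card {u. v \<rightarrow> u}"
    using assms(1) neighbours_bounded(1) by (intro card_le_if_disjoint_meets) auto
  also have "\<dots> \<le> max_degree G"
    using neighbours_bounded(2) out_degree_le_max_degree[OF v(1)] by (rule le_trans)
  finally show ?thesis .
next
  case False
  then obtain v where v: "v \<in> verts G" "v \<notin> X" "\<And>u. u \<in> verts G - X \<Longrightarrow> \<not> (u \<noteq> v \<and> v \<rightarrow> u)"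
    using assms(2,3) unfolding TRD_set_def by blast
  \<comment> \<open>Otherwise \<open>v\<close> would need another neighbour outside
    \<open>A \<union> X\<close>, hence outside \<open>X\<close>.\<close>
  have "A \<inter> {v} \<noteq> {}" if "A \<in> \<A>" for A
    using TRD[OF that] v unfolding TRD_set_def by blast
  then have "card \<A> \<le> card {v}"
    using assms(1) by (intro card_le_if_disjoint_meets) auto
  then show ?thesis
    using assms(4) by simp
qed

lemma (in fin_digraph) card_trc_partition_le:
  assumes \<Phi>: "trc_partition G \<Phi>" and x: "x \<in> verts G" "out_degree G x = 1"
  shows "card \<Phi> \<le> max_degree G + 1"
proof -
  have part: "partition_on (verts G) \<Phi>"
    using \<Phi> by (simp add: trc_partition_def)
  then obtain X where X: "X \<in> \<Phi>" "x \<in> X"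
    using x(1) by (auto simp: partition_on_def)
  have disj: "disjoint \<Phi>"
    using part by (simp add: partition_on_def)
  have "TRD_set G (A \<union> X)" if A: "A \<in> \<Phi> - {X}" for A
  proof -
    obtain B where B: "B \<in> \<Phi>" "TRD_set G (A \<union> B)"
      using \<Phi> A unfolding trc_partition_def total_restrained_coalition_def by blast
    moreover have "x \<notin> A"
      using disj A X by (auto simp: disjoint_def)
    ultimately have "x \<in> B"
      using degree_1_in_TRD_set x by blast
    then have "B = X"
      using disj B(1) X by (auto simp: disjoint_def)
    with B(2) show ?thesis by simp
  qed
  moreover have "disjoint (\<Phi> - {X})"
    using disj by (auto simp: disjoint_def)
  moreover have "X \<subseteq> verts G"
    using part X(1) by (auto simp: partition_on_def)
  moreover have "\<not> TRD_set G X"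
    using \<Phi> X(1) by (simp add: trc_partition_def)
  moreover have "max_degree G \<ge> 1"
    using out_degree_le_max_degree[OF x(1)] x(2) by simp
  ultimately have "card (\<Phi> - {X}) \<le> max_degree G"
    by (intro card_le_if_common_partner)
  \<comment> \<open>The summand 1 counts \<open>X\<close> itself.\<close>
  then show ?thesis
    using X(1) by (simp add: card_Diff_singleton)
qed

theorem theorem2p12:
  fixes G :: "('a, 'b) pre_digraph"
  assumes "graph G"
    and "\<forall>v\<in>verts G. \<not> isolated_vertex G v"
    and "min_degree G = 1"
    and "verts G \<noteq> {}"
  shows "C_tr G \<le> max_degree G + 1"
proof -
  interpret graph G by fact
  have "Min (out_degree G ` verts G) \<in> out_degree G ` verts G"
    using assms(4) by (intro Min_in) auto
  then obtain x where x: "x \<in> verts G" "out_degree G x = 1"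
    using assms(3) unfolding min_degree_def by auto
  have "\<not> isolated_vertex G v" for v
    using assms(2) by (auto simp: isolated_vertex_def)
  \<comment> \<open>\<open>Max\<close> is bounded by its elements only over a nonempty finite
    set.\<close>
  then have "{\<Phi>. trc_partition G \<Phi>} \<noteq> {}"
    using trc_partition_exists[OF assms(1,4)] by auto
  then have "Max (card ` {\<Phi>. trc_partition G \<Phi>}) \<le> max_degree G + 1"
    using finite_trc_partitions[OF assms(1)] card_trc_partition_le[OF _ x]
    by (subst Max_le_iff) auto
  then show ?thesis
    by (simp add: C_tr_def setcompr_eq_image)
qed

end
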